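(* Let $\beta \in (0,d]$ and let $Q_0\subset\mathbb{R}^d$ be a cube. There exist constants $c,C>0$ such that $$\mathcal{H}^{\beta}_\infty\left(\{x\in Q:|u(x)-c_Q|>t\}\right) \leq C\, l(Q)^\beta \exp\left(-ct/\|u\|_{BMO^\beta(Q_0)}\right)$$ for every $t>0$, every $u \in BMO^\beta(Q_0)$, every finite subcube $Q\subset Q_0$ with sides parallel to those of $Q_0$, and suitable constants $c_Q \in \mathbb{R}$ (depending on $u$ and $Q$).
   Context: $\mathcal{H}^{\beta}_{\infty}(E)= \inf \{\sum_{i} \omega_\beta r_i^\beta : E \subset \bigcup_{i} B(x_i,r_i) \}$ (countable ball covers), $\omega_\beta= \pi^{\beta/2}/\Gamma(\beta/2+1)$. $f$ is $\mathcal{H}^\beta_\infty$-quasicontinuous if for every $\epsilon>0$ there is an open $O$ with $\mathcal{H}^\beta_\infty(O)<\epsilon$ and $f|_{O^c}$ continuous. Choquet integral: $\int_A f\,d\mathcal{H}^\beta_\infty=\int_0^\infty \mathcal{H}^\beta_\infty(\{x\in A: f(x)>t\})\,dt$ for $f\ge0$. $L^1(Q_0;\mathcal{H}^\beta_\infty)$: quasicontinuous $f$ with $\int_{Q_0}|f|\,d\mathcal{H}^\beta_\infty<\infty$. $\|u\|_{BMO^{\beta}(Q_0)}= \sup_{Q} \inf_{c \in \mathbb{R}} l(Q)^{-\beta} \int_{Q} |u-c| \,d\mathcal{H}^{\beta}_\infty$ over finite subcubes $Q\subset Q_0$ with sides parallel to those of $Q_0$, $l(Q)$ = side length; $BMO^\beta(Q_0)$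 is the set of $u\in L^1(Q_0;\mathcal{H}^\beta_\infty)$ with this finite. *)

theory Defs
  imports "HOL-Analysis.Analysis"
begin

definition omega :: "real \<Rightarrow> real" where
  "omega \<beta> = pi powr (\<beta> / 2) / Gamma (\<beta> / 2 + 1)"

text \<open>Hausdorff content of dimension beta: infimum over countable covers by balls.
  Finite covers are included (radius-0 balls are empty). Values in ennreal.\<close>
definition hcontent :: "real \<Rightarrow> 'a::euclidean_space set \<Rightarrow> ennreal" where
  "hcontent \<beta> E = (INF (x, r) \<in> {(x :: nat \<Rightarrow> 'a, r :: nat \<Rightarrow> real).
        (\<forall>i. 0 \<le> r i) \<and> E \<subseteq> (\<Union>i. ball (x i) (r i))}.
        (\<Sum>i. ennreal (omega \<beta> * r i powr \<beta>)))"

definition choquet :: "real \<Rightarrow> 'a::euclidean_space set \<Rightarrow> ('a \<Rightarrow> real) \<Rightarrow> ennreal" where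
  "choquet \<beta> A f = (\<integral>\<^sup>+ t. indicator {0<..} t * hcontent \<beta> {x \<in> A. f x > t} \<partial>lborel)"

definition quasicontinuous_on :: "real \<Rightarrow> 'a::euclidean_space set \<Rightarrow> ('a \<Rightarrow> real) \<Rightarrow> bool" where
  "quasicontinuous_on \<beta> S f \<longleftrightarrow>
     (\<forall>\<epsilon>>0. \<exists>U. open U \<and> hcontent \<beta> U < ennreal \<epsilon> \<and> continuous_on (S - U) f)"

definition L1_content :: "real \<Rightarrow> 'a::euclidean_space set \<Rightarrow> ('a \<Rightarrow> real) set" where
  "L1_content \<beta> S = {f. quasicontinuous_on \<beta> S f \<and> choquet \<beta> S (\<lambda>x. \<bar>f x\<bar>) < \<infinity>}"

text \<open>Closed cube with base corner a, side length l, and edge directions given by the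
  orthonormal frame f (an orthogonal transformation): a + f([0,l]^d).\<close>
definition cube :: "('a::euclidean_space \<Rightarrow> 'a) \<Rightarrow> 'a \<Rightarrow> real \<Rightarrow> 'a set" where
  "cube f a l = (\<lambda>x. a + f x) ` cbox 0 (\<Sum>b\<in>Basis. l *\<^sub>R b)"

text \<open>Finite subcubes of Q0 = cube f a0 l0 with sides parallel to those of Q0,
  given as (corner, side length).\<close>
definition subcubes :: "('a::euclidean_space \<Rightarrow> 'a) \<Rightarrow> 'a set \<Rightarrow> ('a \<times> real) set" where
  "subcubes f Q0 = {(b, s). 0 < s \<and> cube f b s \<subseteq> Q0}"

definition bmo_norm :: "real \<Rightarrow> ('a::euclidean_space \<Rightarrow> 'a) \<Rightarrow> 'a set \<Rightarrow> ('a \<Rightarrow> real) \<Rightarrow> ennreal" where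
  "bmo_norm \<beta> f Q0 u = (SUP (b, s) \<in> subcubes f Q0. INF c \<in> (UNIV :: real set).
      ennreal (s powr (-\<beta>)) * choquet \<beta> (cube f b s) (\<lambda>x. \<bar>u x - c\<bar>))"

definition BMO :: "real \<Rightarrow> ('a::euclidean_space \<Rightarrow> 'a) \<Rightarrow> 'a set \<Rightarrow> ('a \<Rightarrow> real) set" where
  "BMO \<beta> f Q0 = {u \<in> L1_content \<beta> Q0. bmo_norm \<beta> f Q0 u < \<infinity>}"

end

theory Submission
  imports Defs
begin

text \<open>
  Chebyshev's inequality turns the BMO condition into a weak one: with A a large multiple of the norm,
  every subcube Q has a constant c(Q) such that E = {x in Q : |u - c(Q)| > A} has content at most
  \<open>\<delta> l(Q)^\<beta>\<close> for a small \<open>\<delta>\<close>. Place the mass \<open>\<omega> r^\<beta>\<close> of each ball of an almost optimal cover of E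
  at the centre of that ball, and take around each point of E the essentially largest ball of radius
  \<open>\<rho>\<close> carrying mass at least \<open>\<theta> \<rho>^\<beta>\<close>. A disjoint Vitali subfamily has \<open>\<Sum> \<rho>^\<beta>\<close> small by additivity of
  the mass, and by maximality E has small content at the scale of each selected ball. Hence the
  subcubes P around these balls cover E, satisfy \<open>\<Sum> l(P)^\<beta> \<le> l(Q)^\<beta> / 2\<close>, and contain points where u is
  within A of both c(P) and c(Q), so |c(P) - c(Q)| \<le> 2A. Iterating, raising the level by 2A
  halves the content. No differentiation theorem is needed since E is covered
  without exceptional set.
\<close>

section \<open>Hausdorff content: subadditivity, Chebyshev's inequality, balls\<close>

lemma omega_pos: "0 < \<beta> \<Longrightarrow> 0 < omega \<beta>"
  by (simp add: omega_def Gamma_real_pos)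

lemma hcontent_leI:
  assumes "\<And>i. 0 \<le> r i" and "E \<subseteq> (\<Union>i::nat. ball (x i) (r i))"
  shows "hcontent \<beta> E \<le> (\<Sum>i. ennreal (omega \<beta> * r i powr \<beta>))"
  unfolding hcontent_def using assms by (intro INF_lower2[of "(x, r)"]) auto

lemma hcontent_lessE:
  fixes E :: "'a::euclidean_space set"
  assumes "hcontent \<beta> E < T"
  obtains x :: "nat \<Rightarrow> 'a" and r :: "nat \<Rightarrow> real" where "\<And>i. 0 \<le> r i" "E \<subseteq> (\<Union>i. ball (x i) (r i))"
    "(\<Sum>i. ennreal (omega \<beta> * r i powr \<beta>)) < T"
proof -
  have "\<exists>p\<in>{(x :: nat \<Rightarrow> 'a, r :: nat \<Rightarrow> real). (\<forall>i. 0 \<le> r i) \<and> E \<subseteq> (\<Union>i. ball (x i) (r i))}.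
     (case p of (x, r) \<Rightarrow> \<Sum>i. ennreal (omega \<beta> * r i powr \<beta>)) < T"
    using assms unfolding hcontent_def INF_less_iff .
  then obtain p where "p \<in> {(x :: nat \<Rightarrow> 'a, r :: nat \<Rightarrow> real). (\<forall>i. 0 \<le> r i) \<and> E \<subseteq> (\<Union>i. ball (x i) (r i))}"
    "(case p of (x, r) \<Rightarrow> \<Sum>i. ennreal (omega \<beta> * r i powr \<beta>)) < T" ..
  then show thesis by (intro that[of "snd p" "fst p"]) (auto simp: case_prod_unfold)
qed

lemma hcontent_mono: "E \<subseteq> F \<Longrightarrow> hcontent \<beta> E \<le> hcontent \<beta> F"
  unfolding hcontent_def by (intro INF_superset_mono) auto

lemma hcontent_empty [simp]: "hcontent \<beta> {} = 0"
  using hcontent_leI[of "\<lambda>_. 0" "{}" "\<lambda>_. 0" \<beta>] by simp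

lemma hcontent_ball_le:
  assumes "0 \<le> r"
  shows "hcontent \<beta> (ball x r) \<le> ennreal (omega \<beta> * r powr \<beta>)"
proof -
  have "hcontent \<beta> (ball x r) \<le> (\<Sum>i. ennreal (omega \<beta> * (if i = (0::nat) then r else 0) powr \<beta>))"
    by (rule hcontent_leI[where x="\<lambda>_. x"]) (use assms in auto)
  also have "\<dots> = (\<Sum>i\<in>{0}. ennreal (omega \<beta> * (if i = (0::nat) then r else 0) powr \<beta>))"
    by (rule suminf_finite) auto
  finally show ?thesis by simp
qed

text \<open>Almost optimal covers of the sets \<open>E i\<close> are merged into one sequence by the
  pairing function; the errors \<open>e * (1/2) ^ Suc i\<close> add up to \<open>e\<close>.\<close>

lemma hcontent_UN_le_suminf:
  fixes E :: "nat \<Rightarrow> 'a::euclidean_space set"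
  shows "hcontent \<beta> (\<Union>i. E i) \<le> (\<Sum>i. hcontent \<beta> (E i))"
proof (rule ennreal_le_epsilon)
  fix e :: real
  assume fin: "(\<Sum>i. hcontent \<beta> (E i)) < top" and "0 < e"
  define P where "P i x r \<longleftrightarrow> (\<forall>j. 0 \<le> r j) \<and> E i \<subseteq> (\<Union>j::nat. ball (x j) (r j)) \<and>
      (\<Sum>j. ennreal (omega \<beta> * r j powr \<beta>)) < hcontent \<beta> (E i) + ennreal (e * (1/2) ^ Suc i)" for i x r
  have "\<exists>x r. P i x r" for i
  proof -
    have "hcontent \<beta> (E i) \<le> (\<Sum>i. hcontent \<beta> (E i))"
      using sum_le_suminf[of "\<lambda>i. hcontent \<beta> (E i)" "{i}"] by simp
    then have "hcontent \<beta> (E i) \<noteq> top" using fin by auto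
    moreover have "0 < ennreal (e * (1/2) ^ Suc i)" using \<open>0 < e\<close> by simp
    ultimately have "hcontent \<beta> (E i) < hcontent \<beta> (E i) + ennreal (e * (1/2) ^ Suc i)"
      using ennreal_add_left_cancel_less[of "hcontent \<beta> (E i)" 0] by (simp add: less_top)
    then show ?thesis by (rule hcontent_lessE) (auto simp: P_def)
  qed
  then obtain x r where P: "\<And>i. P i (x i) (r i)" by metis
  have r: "0 \<le> r i j" and cov: "E i \<subseteq> (\<Union>j. ball (x i j) (r i j))"
    and le: "(\<Sum>j. ennreal (omega \<beta> * r i j powr \<beta>)) < hcontent \<beta> (E i) + ennreal (e * (1/2) ^ Suc i)" for i j
    using P[of i] unfolding P_def by auto
  define X where "X = (\<lambda>k. case prod_decode k of (i, j) \<Rightarrow> x i j)"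
  define R where "R = (\<lambda>k. case prod_decode k of (i, j) \<Rightarrow> r i j)"
  have "(\<Union>i. E i) \<subseteq> (\<Union>k. ball (X k) (R k))"
  proof
    fix z assume "z \<in> (\<Union>i. E i)"
    then obtain i j where "z \<in> ball (x i j) (r i j)" using cov by blast
    then have "z \<in> ball (X (prod_encode (i, j))) (R (prod_encode (i, j)))" by (simp add: X_def R_def)
    then show "z \<in> (\<Union>k. ball (X k) (R k))" by blast
  qed
  then have "hcontent \<beta> (\<Union>i. E i) \<le> (\<Sum>k. ennreal (omega \<beta> * R k powr \<beta>))"
    by (intro hcontent_leI) (auto simp: R_def r split: prod.split)
  also have "\<dots> = (\<Sum>k. (\<lambda>(i, j). ennreal (omega \<beta> * r i j powr \<beta>)) (prod_decode k))"
    by (simp add: R_def case_prod_unfold)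
  also have "\<dots> = (\<Sum>i. \<Sum>j. ennreal (omega \<beta> * r i j powr \<beta>))"
    by (rule suminf_ennreal_2dimen) simp
  also have "\<dots> \<le> (\<Sum>i. hcontent \<beta> (E i) + ennreal (e * (1/2) ^ Suc i))"
    by (intro suminf_le less_imp_le[OF le]) auto
  also have "\<dots> = (\<Sum>i. hcontent \<beta> (E i)) + (\<Sum>i. ennreal (e * (1/2) ^ Suc i))"
    by (rule suminf_add[symmetric]) auto
  also have "(\<Sum>i. ennreal (e * (1/2) ^ Suc i)) = ennreal e"
    using sums_mult[OF power_half_series, of e] \<open>0 < e\<close>
    by (intro suminf_ennreal_eq) auto
  finally show "hcontent \<beta> (\<Union>i. E i) \<le> (\<Sum>i. hcontent \<beta> (E i)) + ennreal e" .
qed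

text \<open>The sum is an integral over \<open>count_space\<close> because the families selected
  later are indexed by countable sets of points. Numbers that encode no element of \<open>I\<close>
  receive the empty set, of content 0.\<close>

lemma hcontent_UN_le:
  assumes "countable I"
  shows "hcontent \<beta> (\<Union>i\<in>I. E i) \<le> (\<integral>\<^sup>+i. hcontent \<beta> (E i) \<partial>count_space I)"
proof -
  let ?N = "to_nat_on I ` I"
  define F where "F n = (if n \<in> ?N then E (from_nat_into I n) else {})" for n
  have *: "i \<in> I \<Longrightarrow> F (to_nat_on I i) = E i" for i
    using assms by (simp add: F_def)
  have "(\<Union>i\<in>I. E i) \<subseteq> (\<Union>n. F n)" using * by blast
  then have "hcontent \<beta> (\<Union>i\<in>I. E i) \<le> (\<Sum>n. hcontent \<beta> (F n))"
    by (rule order_trans[OF hcontent_mono hcontent_UN_le_suminf])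
  also have "\<dots> = (\<integral>\<^sup>+n. hcontent \<beta> (F n) \<partial>count_space UNIV)"
    by (simp add: nn_integral_count_space_nat)
  also have "\<dots> = (\<integral>\<^sup>+n. hcontent \<beta> (F n) \<partial>count_space ?N)"
    by (simp add: nn_integral_count_space_indicator, rule nn_integral_cong)
      (auto simp: F_def split: split_indicator)
  also have "\<dots> = (\<integral>\<^sup>+i. hcontent \<beta> (F (to_nat_on I i)) \<partial>count_space I)"
    using assms by (intro nn_integral_bij_count_space[symmetric]) (simp add: bij_betw_def inj_on_to_nat_on)
  also have "\<dots> = (\<integral>\<^sup>+i. hcontent \<beta> (E i) \<partial>count_space I)"
    by (rule nn_integral_cong) (simp add: *)
  finally show ?thesis .
qed

lemma hcontent_Un_le: "hcontent \<beta> (E \<union> F) \<le> hcontent \<beta> E + hcontent \<beta> F"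
proof -
  have "hcontent \<beta> (\<Union>b\<in>UNIV. if b then E else F) \<le> (\<integral>\<^sup>+b. hcontent \<beta> (if b then E else F) \<partial>count_space UNIV)"
    by (rule hcontent_UN_le) auto
  then show ?thesis by (simp add: UNIV_bool nn_integral_count_space_finite Un_commute add.commute)
qed

text \<open>Superlevel sets shrink as the level grows, so on \<open>{0<..t}\<close> the integrand of
  the Choquet integral is at least its value at \<open>t\<close>.\<close>

lemma choquet_Chebyshev:
  assumes "0 < t"
  shows "ennreal t * hcontent \<beta> {x \<in> A. g x > t} \<le> choquet \<beta> A g"
proof -
  have "ennreal t * hcontent \<beta> {x \<in> A. g x > t}
      = (\<integral>\<^sup>+ s. hcontent \<beta> {x \<in> A. g x > t} * indicator {0<..t} s \<partial>lborel)"
    using assms by (subst nn_integral_cmult_indicator) (auto simp: mult.commute)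
  also have "\<dots> \<le> choquet \<beta> A g"
    unfolding choquet_def
    by (intro nn_integral_mono) (auto split: split_indicator intro!: hcontent_mono)
  finally show ?thesis .
qed

text \<open>Comparison of volumes. In a cheaper cover all radii \<open>q i\<close> are below
  \<open>r\<close>; as \<beta> is at most the dimension d, \<open>q i ^ d\<close> is then at most
  \<open>r powr (d - \<beta>) * q i powr \<beta>\<close>, and the total volume falls short of that
  of the ball.\<close>

lemma hcontent_ball_ge:
  fixes x :: "'a::euclidean_space"
  assumes "0 < \<beta>" and "\<beta> \<le> real DIM('a)" and "0 < r"
  shows "ennreal (omega \<beta> * r powr \<beta>) \<le> hcontent \<beta> (ball x r)"
proof (rule ccontr)
  assume "\<not> ?thesis"
  then have "hcontent \<beta> (ball x r) < ennreal (omega \<beta> * r powr \<beta>)" by simp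
  then obtain y :: "nat \<Rightarrow> 'a" and q :: "nat \<Rightarrow> real" where q: "\<And>i. 0 \<le> q i" and cov: "ball x r \<subseteq> (\<Union>i. ball (y i) (q i))"
    and less: "(\<Sum>i. ennreal (omega \<beta> * q i powr \<beta>)) < ennreal (omega \<beta> * r powr \<beta>)"
    by (rule hcontent_lessE) metis
  let ?d = "DIM('a)"
  have q_less: "q i < r" for i
  proof (rule ccontr)
    assume "\<not> q i < r"
    then have "ennreal (omega \<beta> * r powr \<beta>) \<le> ennreal (omega \<beta> * q i powr \<beta>)"
      using assms omega_pos[of \<beta>] by (intro ennreal_leI mult_left_mono powr_mono2) auto
    also have "\<dots> \<le> (\<Sum>i. ennreal (omega \<beta> * q i powr \<beta>))"
      using sum_le_suminf[of "\<lambda>i. ennreal (omega \<beta> * q i powr \<beta>)" "{i}"] by simp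
    finally show False using less by simp
  qed
  \<comment> \<open>Volume per unit of content: \<open>K * (omega \<beta> * r powr \<beta>)\<close>
    is exactly the volume of the ball of radius \<open>r\<close>.\<close>
  define K where "K = unit_ball_vol (real ?d) * r powr (real ?d - \<beta>) / omega \<beta>"
  have K: "0 < K" unfolding K_def using assms omega_pos[of \<beta>] by simp
  have vol: "unit_ball_vol (real ?d) * q i ^ ?d \<le> K * (omega \<beta> * q i powr \<beta>)" for i
  proof (cases "q i = 0")
    case False
    then have "q i > 0" using q[of i] by simp
    then have "q i ^ ?d = q i powr (real ?d - \<beta>) * q i powr \<beta>"
      by (simp add: powr_realpow[symmetric] powr_add[symmetric])
    also have "\<dots> \<le> r powr (real ?d - \<beta>) * q i powr \<beta>"
      using assms q_less[of i] q[of i] by (intro mult_right_mono powr_mono2) auto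
    finally show ?thesis using omega_pos[of \<beta>] assms by (simp add: K_def mult_left_mono mult.assoc)
  qed (simp add: zero_power)
  have "ennreal (unit_ball_vol (real ?d) * r ^ ?d) = emeasure lborel (ball x r)"
    using assms by (simp add: emeasure_ball)
  also have "\<dots> \<le> emeasure lborel (\<Union>i. ball (y i) (q i))"
    by (intro emeasure_mono cov) auto
  also have "\<dots> \<le> (\<Sum>i. emeasure lborel (ball (y i) (q i)))"
    by (intro emeasure_subadditive_countably) auto
  also have "\<dots> \<le> (\<Sum>i. ennreal K * ennreal (omega \<beta> * q i powr \<beta>))"
    by (intro suminf_le) (use q vol K in \<open>auto simp: emeasure_ball ennreal_mult'[symmetric] intro!: ennreal_leI\<close>)
  also have "\<dots> = ennreal K * (\<Sum>i. ennreal (omega \<beta> * q i powr \<beta>))"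
    by simp
  also have "\<dots> < ennreal K * ennreal (omega \<beta> * r powr \<beta>)"
    using less K by (intro ennreal_mult_strict_left_mono) auto
  also have "\<dots> = ennreal (unit_ball_vol (real ?d) * r ^ ?d)"
    using K omega_pos[of \<beta>] assms
    by (simp add: K_def ennreal_mult'[symmetric] powr_realpow[symmetric] powr_add[symmetric])
  finally show False by simp
qed

section \<open>Selecting balls by the mass of a cover\<close>

lemma emeasure_density_count_space_nat:
  fixes w :: "nat \<Rightarrow> ennreal"
  shows "emeasure (density (count_space UNIV) w) I = (\<Sum>i. w i * indicator I i)"
  by (simp add: emeasure_density nn_integral_count_space_nat)

text \<open>The masses sit on the indices of the cover, so balls with a common centre simply add up.
  The bound on \<theta> says that the mass of a covering ball is still enough for twice its radius.
  The factor \<open>R\<close> stays free because the enlarged ball will have to contain a whole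
  cube.\<close>

lemma vitali_selection:
  fixes E :: "'a::euclidean_space set"
  assumes \<beta>: "0 < \<beta>" and \<theta>: "0 < \<theta>" "\<theta> * 2 powr \<beta> \<le> omega \<beta>" and R: "1 \<le> R"
    and T: "hcontent \<beta> E < ennreal T"
  obtains J \<rho> where "countable J" "J \<subseteq> E" "E \<subseteq> (\<Union>x\<in>J. cball x (5 * \<rho> x))"
    "(\<integral>\<^sup>+x. ennreal (\<rho> x powr \<beta>) \<partial>count_space J) \<le> ennreal (T / \<theta>)"
    "\<And>x. x \<in> J \<Longrightarrow> 0 < \<rho> x"
    "\<And>x. x \<in> J \<Longrightarrow> hcontent \<beta> (E \<inter> ball x (R * \<rho> x)) \<le> ennreal (\<theta> * (2 * R * \<rho> x) powr \<beta>)"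
proof -
  obtain y :: "nat \<Rightarrow> 'a" and r :: "nat \<Rightarrow> real" where r: "\<And>i. 0 \<le> r i" and cov: "E \<subseteq> (\<Union>i. ball (y i) (r i))"
    and sum_less: "(\<Sum>i. ennreal (omega \<beta> * r i powr \<beta>)) < ennreal T"
    using T by (rule hcontent_lessE) metis
  have T_pos: "0 < T"
    using T by (metis ennreal_neg linorder_not_less not_less_zero)
  define w where "w i = ennreal (omega \<beta> * r i powr \<beta>)" for i
  define M where "M = density (count_space UNIV) w"
  define I where "I x t = {i. y i \<in> cball x t}" for x t
  \<comment> \<open>Radii of the balls around \<open>x\<close> that are rich in mass. The total mass
    is at most \<open>T\<close>, which bounds all of them by \<open>B\<close>.\<close>
  define G where "G x = {t. 0 < t \<and> ennreal (\<theta> * t powr \<beta>) \<le> emeasure M (I x t)}" for x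
  define B where "B = (T / \<theta>) powr (1 / \<beta>)"
  have M_le: "emeasure M X \<le> ennreal T" for X
  proof -
    have "emeasure M X \<le> emeasure M UNIV" by (intro emeasure_mono) (auto simp: M_def)
    also have "\<dots> = (\<Sum>i. w i)" by (simp add: M_def emeasure_density_count_space_nat)
    finally show ?thesis using sum_less by (simp add: w_def)
  qed
  have w_le: "w i \<le> emeasure M X" if "i \<in> X" for i X
  proof -
    have "w i = (\<Sum>j\<in>{i}. w j * indicator X j)" using that by simp
    also have "\<dots> \<le> (\<Sum>j. w j * indicator X j)" by (intro sum_le_suminf) auto
    finally show ?thesis by (simp add: M_def emeasure_density_count_space_nat)
  qed
  have G_le: "t \<le> B" if "t \<in> G x" for x t
  proof -
    have "ennreal (\<theta> * t powr \<beta>) \<le> ennreal T" using that M_le order_trans by (auto simp: G_def)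
    then have "t powr \<beta> \<le> T / \<theta>" using T_pos \<theta> by (simp add: field_simps ennreal_le_iff)
    then have "(t powr \<beta>) powr (1 / \<beta>) \<le> B" unfolding B_def using \<beta> by (intro powr_mono2) auto
    then show ?thesis using that \<beta> by (simp add: powr_powr G_def)
  qed
  \<comment> \<open>A radius above half the supremum of \<open>G x\<close> serves, which avoids
    asking whether the supremum is attained; hence the factor 2. A covering ball that contains
    \<open>x\<close> has its centre within \<open>r i\<close> of \<open>x\<close>, so
    \<open>r i\<close> belongs to \<open>G x\<close>.\<close>
  have "\<exists>\<rho>. \<rho> \<in> G x \<and> (\<forall>t\<ge>2 * \<rho>. t \<notin> G x)" if "x \<in> E" for x
  proof -
    obtain i where i: "x \<in> ball (y i) (r i)" using cov \<open>x \<in> E\<close> by blast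
    then have ri: "0 < r i" by (auto intro: le_less_trans[OF zero_le_dist])
    have "\<theta> * 1 \<le> \<theta> * 2 powr \<beta>" using \<theta> \<beta> by (intro mult_left_mono ge_one_powr_ge_zero) auto
    then have "\<theta> \<le> omega \<beta>" using \<theta> by linarith
    then have "ennreal (\<theta> * r i powr \<beta>) \<le> w i"
      unfolding w_def using \<theta> by (intro ennreal_leI mult_right_mono) auto
    also have "w i \<le> emeasure M (I x (r i))" using i by (intro w_le) (auto simp: I_def dist_commute)
    finally have ri_G: "r i \<in> G x" using ri by (simp add: G_def)
    have bdd: "bdd_above (G x)" using G_le by (rule bdd_aboveI)
    have "0 < Sup (G x)" using ri cSup_upper[OF ri_G bdd] by simp
    then have "Sup (G x) / 2 < Sup (G x)" by simp
    then obtain \<rho> where "\<rho> \<in> G x" "Sup (G x) / 2 < \<rho>"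
      using less_cSup_iff[OF _ bdd] ri_G by blast
    moreover have "t \<le> Sup (G x)" if "t \<in> G x" for t using that bdd by (rule cSup_upper)
    ultimately show ?thesis by (intro exI[of _ \<rho>]) force
  qed
  then obtain \<rho> where \<rho>: "\<And>x. x \<in> E \<Longrightarrow> \<rho> x \<in> G x" and \<rho>_max: "\<And>x t. x \<in> E \<Longrightarrow> 2 * \<rho> x \<le> t \<Longrightarrow> t \<notin> G x"
    by metis
  have \<rho>_pos: "0 < \<rho> x" if "x \<in> E" for x using \<rho>[OF that] by (simp add: G_def)
  obtain J where J: "countable J" "J \<subseteq> E"
    and disj: "pairwise (\<lambda>i j. disjnt (cball i (\<rho> i)) (cball j (\<rho> j))) J"
    and J_cov: "E \<subseteq> (\<Union>x\<in>J. cball x (5 * \<rho> x))"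
  proof (rule Vitali_covering_lemma_cballs[where S = E and K = E and a = "\<lambda>x. x" and r = \<rho> and B = B])
    show "E \<subseteq> (\<Union>x\<in>E. cball x (\<rho> x))" using \<rho>_pos by (force simp: less_imp_le)
    show "0 < \<rho> x \<and> \<rho> x \<le> B" if "x \<in> E" for x using \<rho>_pos[OF that] G_le[OF \<rho>[OF that]] by simp
  qed (rule that)
  have "ennreal \<theta> * (\<integral>\<^sup>+x. ennreal (\<rho> x powr \<beta>) \<partial>count_space J)
      = (\<integral>\<^sup>+x. ennreal (\<theta> * \<rho> x powr \<beta>) \<partial>count_space J)"
    using \<theta> by (simp add: nn_integral_cmult[symmetric] ennreal_mult'[symmetric])
  also have "\<dots> \<le> (\<integral>\<^sup>+x. emeasure M (I x (\<rho> x)) \<partial>count_space J)"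
    using \<rho> J by (intro nn_integral_mono) (auto simp: G_def)
  \<comment> \<open>Disjoint balls contain disjoint sets of centres, so their masses add.\<close>
  also have "\<dots> = emeasure M (\<Union>x\<in>J. I x (\<rho> x))"
    using disj J by (intro emeasure_UN_countable[symmetric])
      (auto simp: M_def I_def disjoint_family_on_def pairwise_def disjnt_iff)
  also have "\<dots> \<le> ennreal T" by (rule M_le)
  also have "\<dots> = ennreal \<theta> * ennreal (T / \<theta>)"
    using \<theta> T_pos by (simp add: ennreal_mult'[symmetric])
  finally have J_sum: "(\<integral>\<^sup>+x. ennreal (\<rho> x powr \<beta>) \<partial>count_space J) \<le> ennreal (T / \<theta>)"
    using \<theta> by (simp add: ennreal_mult_le_mult_iff)
  have J_le: "hcontent \<beta> (E \<inter> ball x (R * \<rho> x)) \<le> ennreal (\<theta> * (2 * R * \<rho> x) powr \<beta>)" if "x \<in> E" for x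
  proof -
    let ?X = "I x (2 * R * \<rho> x)"
    \<comment> \<open>Covering balls centred farther than \<open>2 * R * \<rho> x\<close> from
      \<open>x\<close> miss this set and are shrunk to radius 0. The others cost the mass of
      \<open>?X\<close>, which is small because \<open>2 * R * \<rho> x\<close> is too large a
      radius to lie in \<open>G x\<close>.\<close>
    have "E \<inter> ball x (R * \<rho> x) \<subseteq> (\<Union>i. ball (y i) (if i \<in> ?X then r i else 0))"
    proof
      fix z assume z: "z \<in> E \<inter> ball x (R * \<rho> x)"
      then obtain i where i: "z \<in> ball (y i) (r i)" using cov by blast
      have d: "dist x (y i) < R * \<rho> x + r i"
        using z i dist_triangle[of x "y i" z] by (simp add: dist_commute)
      \<comment> \<open>A larger ball would put too much mass within distance \<open>2 * r i\<close> of \<open>x\<close>.\<close>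
      have "r i \<le> R * \<rho> x"
      proof (rule ccontr)
        assume "\<not> ?thesis"
        then have ri: "R * \<rho> x < r i" by simp
        have le: "\<rho> x \<le> R * \<rho> x" using R \<rho>_pos[OF that] by simp
        have "\<theta> * (2 * r i) powr \<beta> = \<theta> * 2 powr \<beta> * r i powr \<beta>" using r by (simp add: powr_mult)
        also have "\<dots> \<le> omega \<beta> * r i powr \<beta>" using \<theta> by (intro mult_right_mono) auto
        finally have "ennreal (\<theta> * (2 * r i) powr \<beta>) \<le> w i" unfolding w_def by (rule ennreal_leI)
        also have "\<dots> \<le> emeasure M (I x (2 * r i))" using d ri by (intro w_le) (simp add: I_def)
        finally have "ennreal (\<theta> * (2 * r i) powr \<beta>) \<le> emeasure M (I x (2 * r i))" .
        moreover have "0 < r i" using ri le \<rho>_pos[OF that] by linarith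
        ultimately have "2 * r i \<in> G x" by (simp add: G_def)
        then show False using \<rho>_max[OF that, of "2 * r i"] ri le by simp
      qed
      then have "i \<in> ?X" using d by (simp add: I_def)
      then have "z \<in> ball (y i) (if i \<in> ?X then r i else 0)" using i by simp
      then show "z \<in> (\<Union>i. ball (y i) (if i \<in> ?X then r i else 0))" by blast
    qed
    then have "hcontent \<beta> (E \<inter> ball x (R * \<rho> x)) \<le> (\<Sum>i. ennreal (omega \<beta> * (if i \<in> ?X then r i else 0) powr \<beta>))"
      using r by (intro hcontent_leI) auto
    also have "\<dots> = emeasure M ?X"
      unfolding M_def emeasure_density_count_space_nat w_def
      by (intro suminf_cong) (auto split: split_indicator)
    also have "\<dots> \<le> ennreal (\<theta> * (2 * R * \<rho> x) powr \<beta>)"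
    proof -
      have "2 * \<rho> x \<le> 2 * R * \<rho> x" using R \<rho>_pos[OF that] by simp
      then show ?thesis using \<rho>_max[OF that, of "2 * R * \<rho> x"] \<rho>_pos[OF that] by (auto simp: G_def)
    qed
    finally show ?thesis .
  qed
  show thesis
    by (rule that[OF J(1,2) J_cov J_sum \<rho>_pos J_le]) (use J in auto)
qed

section \<open>Cubes along an orthonormal frame\<close>

lemma mem_cube_iff:
  "x \<in> cube f b s \<longleftrightarrow> (\<exists>p. x = b + f p \<and> (\<forall>i\<in>Basis. 0 \<le> p \<bullet> i \<and> p \<bullet> i \<le> s))"
  by (auto simp: cube_def mem_box image_iff)

lemma dist_cube_le:
  fixes f :: "'a::euclidean_space \<Rightarrow> 'a"
  assumes f: "orthogonal_transformation f" and "x \<in> cube f b s" and "y \<in> cube f b s"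
  shows "dist x y \<le> real DIM('a) * s"
proof -
  obtain p where p: "x = b + f p" "\<And>i. i \<in> Basis \<Longrightarrow> 0 \<le> p \<bullet> i \<and> p \<bullet> i \<le> s"
    using assms(2) by (auto simp: mem_cube_iff)
  obtain q where q: "y = b + f q" "\<And>i. i \<in> Basis \<Longrightarrow> 0 \<le> q \<bullet> i \<and> q \<bullet> i \<le> s"
    using assms(3) by (auto simp: mem_cube_iff)
  have "dist x y = norm (p - q)"
    using f by (simp add: p q dist_norm orthogonal_transformation_norm
        orthogonal_transformation_linear linear_diff[symmetric])
  also have "\<dots> \<le> (\<Sum>i\<in>Basis. \<bar>(p - q) \<bullet> i\<bar>)" by (rule norm_le_l1)
  also have "\<dots> \<le> (\<Sum>i\<in>(Basis :: 'a set). s)"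
    by (intro sum_mono) (use p q in \<open>force simp: inner_diff_left abs_le_iff\<close>)
  finally show ?thesis by simp
qed

lemma hcontent_cube_le:
  fixes f :: "'a::euclidean_space \<Rightarrow> 'a"
  assumes f: "orthogonal_transformation f" and "0 < s"
  shows "hcontent \<beta> (cube f b s) \<le> ennreal (omega \<beta> * ((real DIM('a) + 1) * s) powr \<beta>)"
proof -
  have "b + f 0 \<in> cube f b s" using \<open>0 < s\<close> by (auto simp: mem_cube_iff)
  \<comment> \<open>The extra 1 makes up for the ball being open.\<close>
  then have "cube f b s \<subseteq> ball (b + f 0) ((real DIM('a) + 1) * s)"
    using dist_cube_le[OF f] \<open>0 < s\<close> by (fastforce simp: algebra_simps)
  then show ?thesis
    by (rule order_trans[OF hcontent_mono hcontent_ball_le]) (use \<open>0 < s\<close> in simp)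
qed

text \<open>The inscribed ball gives the bound. It is the reason why two sets of small content
  cannot fill a cube.\<close>

lemma hcontent_cube_ge:
  fixes f :: "'a::euclidean_space \<Rightarrow> 'a"
  assumes "0 < \<beta>" and "\<beta> \<le> real DIM('a)" and f: "orthogonal_transformation f" and "0 < s"
  shows "ennreal (omega \<beta> * (s / 2) powr \<beta>) \<le> hcontent \<beta> (cube f b s)"
proof -
  define m where "m = (\<Sum>i\<in>Basis. (s / 2) *\<^sub>R i :: 'a)"
  have "ball (b + f m) (s / 2) \<subseteq> cube f b s"
  proof
    fix z assume z: "z \<in> ball (b + f m) (s / 2)"
    obtain p where p: "z - b = f p"
      using orthogonal_transformation_surj[OF f] by (metis surj_def)
    have "norm (m - p) = norm (f (m - p))" using f by (simp add: orthogonal_transformation_norm)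
    also have "f (m - p) = b + f m - z"
      using p f by (simp add: orthogonal_transformation_linear linear_diff algebra_simps)
    also have "norm \<dots> < s / 2" using z by (simp add: dist_norm)
    finally have less: "norm (m - p) < s / 2" .
    have "0 \<le> p \<bullet> i \<and> p \<bullet> i \<le> s" if "i \<in> Basis" for i
      using Basis_le_norm[OF that, of "m - p"] less that
      by (simp add: m_def inner_diff_left abs_le_iff)
    then show "z \<in> cube f b s" using p by (auto simp: mem_cube_iff algebra_simps intro!: exI[of _ p])
  qed
  then show ?thesis
    using assms by (intro order_trans[OF hcontent_ball_ge hcontent_mono]) auto
qed

text \<open>The cube of side \<open>2 * r\<close> centred at \<open>x\<close> may stick out of the
  large cube. Its side is at most \<open>s\<close>, so it can be pushed back in along each
  coordinate, and this loses no point of the large cube.\<close>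

lemma ex_subcube_around:
  fixes f :: "'a::euclidean_space \<Rightarrow> 'a"
  assumes f: "orthogonal_transformation f" and x: "x \<in> cube f b s" and r: "0 \<le> r" "2 * r \<le> s"
  shows "\<exists>b'. cube f b' (2 * r) \<subseteq> cube f b s \<and> cube f b s \<inter> cball x r \<subseteq> cube f b' (2 * r)"
proof -
  obtain p where p: "x = b + f p" "\<And>i. i \<in> Basis \<Longrightarrow> 0 \<le> p \<bullet> i \<and> p \<bullet> i \<le> s"
    using x by (auto simp: mem_cube_iff)
  \<comment> \<open>The corner \<open>p \<bullet> i - r\<close> of the centred cube, clamped to the
    interval from 0 to \<open>s - 2 * r\<close>.\<close>
  define q where "q = (\<Sum>i\<in>Basis. max 0 (min (p \<bullet> i - r) (s - 2 * r)) *\<^sub>R i)"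
  have q: "q \<bullet> i = max 0 (min (p \<bullet> i - r) (s - 2 * r))" if "i \<in> Basis" for i
    using that by (simp add: q_def)
  show ?thesis
  proof (intro exI[of _ "b + f q"] conjI)
    show "cube f (b + f q) (2 * r) \<subseteq> cube f b s"
    proof
      fix z assume "z \<in> cube f (b + f q) (2 * r)"
      then obtain v where v: "z = b + f q + f v" "\<And>i. i \<in> Basis \<Longrightarrow> 0 \<le> v \<bullet> i \<and> v \<bullet> i \<le> 2 * r"
        by (auto simp: mem_cube_iff)
      have "z = b + f (q + v)" using f v by (simp add: orthogonal_transformation_linear linear_add)
      moreover have "0 \<le> (q + v) \<bullet> i \<and> (q + v) \<bullet> i \<le> s" if "i \<in> Basis" for i
        using v(2)[OF that] q[OF that] r by (auto simp: inner_add_left)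
      ultimately show "z \<in> cube f b s" by (auto simp: mem_cube_iff)
    qed
    show "cube f b s \<inter> cball x r \<subseteq> cube f (b + f q) (2 * r)"
    proof
      fix z assume z: "z \<in> cube f b s \<inter> cball x r"
      then obtain v where v: "z = b + f v" "\<And>i. i \<in> Basis \<Longrightarrow> 0 \<le> v \<bullet> i \<and> v \<bullet> i \<le> s"
        by (auto simp: mem_cube_iff)
      have "norm (p - v) = dist x z"
        using f by (simp add: p v dist_norm orthogonal_transformation_norm
            orthogonal_transformation_linear linear_diff[symmetric])
      then have le: "norm (p - v) \<le> r" using z by simp
      have "z = (b + f q) + f (v - q)" using f v by (simp add: orthogonal_transformation_linear linear_diff)
      moreover have "0 \<le> (v - q) \<bullet> i \<and> (v - q) \<bullet> i \<le> 2 * r" if "i \<in> Basis" for i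
        using v(2)[OF that] q[OF that] r p(2)[OF that] Basis_le_norm[OF that, of "p - v"] le
        by (auto simp: inner_diff_left abs_le_iff)
      ultimately show "z \<in> cube f (b + f q) (2 * r)" by (auto simp: mem_cube_iff)
    qed
  qed
qed

section \<open>Covering subcubes and the decay iteration\<close>

text \<open>Each ball \<open>cball x (5 * \<rho> x)\<close> of the Vitali selection is replaced by a
  subcube of side \<open>10 * \<rho> x\<close>. The condition on \<delta> turns the Vitali sum into
  at most half of \<open>s powr \<beta>\<close>, the halving that drives the iteration. The last
  conclusion serves to compare the constants of a cube and its selected subcubes.\<close>

lemma subcube_selection:
  fixes f :: "'a::euclidean_space \<Rightarrow> 'a"
  assumes \<beta>: "0 < \<beta>" and f: "orthogonal_transformation f"
    and \<theta>: "0 < \<theta>" "\<theta> * 2 powr \<beta> \<le> omega \<beta>" and \<delta>: "0 < \<delta>" "4 * \<delta> * 10 powr \<beta> \<le> \<theta>"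
    and s: "0 < s" and E: "E \<subseteq> cube f b s" "hcontent \<beta> E \<le> ennreal (\<delta> * s powr \<beta>)"
  obtains J :: "'a set" and b' :: "'a \<Rightarrow> 'a" and L :: "'a \<Rightarrow> real" where "countable J" "E \<subseteq> (\<Union>x\<in>J. cube f (b' x) (L x))"
    "(\<integral>\<^sup>+x. ennreal (L x powr \<beta>) \<partial>count_space J) \<le> ennreal (s powr \<beta> / 2)"
    "\<And>x. x \<in> J \<Longrightarrow> 0 < L x" "\<And>x. x \<in> J \<Longrightarrow> cube f (b' x) (L x) \<subseteq> cube f b s"
    "\<And>x. x \<in> J \<Longrightarrow> hcontent \<beta> (E \<inter> cube f (b' x) (L x))
        \<le> ennreal (\<theta> * ((10 * real DIM('a) + 1) * L x) powr \<beta>)"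
proof -
  \<comment> \<open>A cube of side \<open>10 * \<rho> x\<close> that contains \<open>x\<close> stays
    within \<open>10 * d * \<rho> x\<close> of it, d being the dimension; adding 1 puts it into an
    open ball.\<close>
  define R where "R = 10 * real DIM('a) + 1"
  have R: "1 \<le> R" by (simp add: R_def)
  \<comment> \<open>The factor 2 makes room for the strict inequality and explains why 4, not 2,
    stands in the condition on \<delta>.\<close>
  have "hcontent \<beta> E < ennreal (2 * \<delta> * s powr \<beta>)"
    using E(2) by (rule le_less_trans) (use \<delta> s in \<open>simp add: ennreal_less_iff\<close>)
  then obtain J \<rho> where J: "countable J" "J \<subseteq> E"
    and cov: "E \<subseteq> (\<Union>x\<in>J. cball x (5 * \<rho> x))"
    and sum_le: "(\<integral>\<^sup>+x. ennreal (\<rho> x powr \<beta>) \<partial>count_space J) \<le> ennreal (2 * \<delta> * s powr \<beta> / \<theta>)"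
    and \<rho>: "\<And>x. x \<in> J \<Longrightarrow> 0 < \<rho> x"
    and small: "\<And>x. x \<in> J \<Longrightarrow> hcontent \<beta> (E \<inter> ball x (R * \<rho> x)) \<le> ennreal (\<theta> * (2 * R * \<rho> x) powr \<beta>)"
  proof (rule vitali_selection[OF \<beta> \<theta> R], goal_cases)
    case (1 J \<rho>)
    show ?case using 1(2-) by (rule that)
  qed
  have "(\<integral>\<^sup>+x. ennreal ((10 * \<rho> x) powr \<beta>) \<partial>count_space J)
      = ennreal (10 powr \<beta>) * (\<integral>\<^sup>+x. ennreal (\<rho> x powr \<beta>) \<partial>count_space J)"
    using \<rho> by (subst nn_integral_cmult[symmetric])
      (auto simp: powr_mult ennreal_mult' less_imp_le intro!: nn_integral_cong)
  also have "\<dots> \<le> ennreal (10 powr \<beta>) * ennreal (2 * \<delta> * s powr \<beta> / \<theta>)"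
    using sum_le by (rule mult_left_mono) simp
  also have "\<dots> = ennreal (s powr \<beta> / 2 * (4 * \<delta> * 10 powr \<beta> / \<theta>))"
    by (simp add: ennreal_mult'[symmetric] field_simps)
  also have "\<dots> \<le> ennreal (s powr \<beta> / 2)"
    using \<delta> \<theta> by (intro ennreal_leI mult_left_le) auto
  finally have L_sum: "(\<integral>\<^sup>+x. ennreal ((10 * \<rho> x) powr \<beta>) \<partial>count_space J) \<le> ennreal (s powr \<beta> / 2)" .
  \<comment> \<open>One term is at most the whole sum, so each side fits into the large cube, as
    \<open>ex_subcube_around\<close> demands.\<close>
  have L_le: "10 * \<rho> x \<le> s" if "x \<in> J" for x
  proof -
    have "ennreal ((10 * \<rho> x) powr \<beta>) \<le> (\<integral>\<^sup>+x. ennreal ((10 * \<rho> x) powr \<beta>) \<partial>count_space J)"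
      using that by (rule nn_integral_ge_point)
    also note L_sum
    finally have "(10 * \<rho> x) powr \<beta> \<le> s powr \<beta> / 2" by (simp add: ennreal_le_iff)
    also have "\<dots> \<le> s powr \<beta>" by simp
    finally show ?thesis using powr_less_mono2[of \<beta> s "10 * \<rho> x"] \<beta> s by fastforce
  qed
  have "\<exists>b'. cube f b' (10 * \<rho> x) \<subseteq> cube f b s \<and> cube f b s \<inter> cball x (5 * \<rho> x) \<subseteq> cube f b' (10 * \<rho> x)"
    if "x \<in> J" for x
    using ex_subcube_around[OF f, of x b s "5 * \<rho> x"] L_le[OF that] \<rho>[OF that] that J E by auto
  then obtain b' where sub: "\<And>x. x \<in> J \<Longrightarrow> cube f (b' x) (10 * \<rho> x) \<subseteq> cube f b s"
    and sup: "\<And>x. x \<in> J \<Longrightarrow> cube f b s \<inter> cball x (5 * \<rho> x) \<subseteq> cube f (b' x) (10 * \<rho> x)"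
    by metis
  show thesis
  proof (rule that[where J = J and b' = b' and L = "\<lambda>x. 10 * \<rho> x"])
    show "E \<subseteq> (\<Union>x\<in>J. cube f (b' x) (10 * \<rho> x))" using cov sup E(1) by blast
    fix x assume x: "x \<in> J"
    have "x \<in> cube f b s \<inter> cball x (5 * \<rho> x)" using x J(2) E(1) \<rho>[OF x] by auto
    with sup[OF x] have "x \<in> cube f (b' x) (10 * \<rho> x)" by (rule subsetD)
    then have "cube f (b' x) (10 * \<rho> x) \<subseteq> ball x (R * \<rho> x)"
      using dist_cube_le[OF f] \<rho>[OF x] by (fastforce simp: R_def algebra_simps)
    then have "hcontent \<beta> (E \<inter> cube f (b' x) (10 * \<rho> x)) \<le> hcontent \<beta> (E \<inter> ball x (R * \<rho> x))"
      by (intro hcontent_mono) auto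
    also note small[OF x]
    \<comment> \<open>Enlarging 2 to 10 expresses the bound through the side
      \<open>10 * \<rho> x\<close>.\<close>
    also have "ennreal (\<theta> * (2 * R * \<rho> x) powr \<beta>) \<le> ennreal (\<theta> * (R * (10 * \<rho> x)) powr \<beta>)"
      using \<theta> \<rho>[OF x] \<beta> by (intro ennreal_leI mult_left_mono powr_mono2) (auto simp: R_def)
    finally show "hcontent \<beta> (E \<inter> cube f (b' x) (10 * \<rho> x))
        \<le> ennreal (\<theta> * ((10 * real DIM('a) + 1) * (10 * \<rho> x)) powr \<beta>)"
      by (simp add: R_def)
  qed (use J \<rho> sub L_sum in auto)
qed

text \<open>Induction on \<open>n\<close> for all subcubes at once, since each step passes to
  subcubes with other constants. The assumption \<open>small\<close> prevents the two exceptional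
  sets from filling a subcube. The level starts at \<open>A\<close>, so every level set lies in the
  set that the selected subcubes cover.\<close>

lemma content_decay:
  fixes f :: "'a::euclidean_space \<Rightarrow> 'a" and u :: "'a \<Rightarrow> real" and c :: "'a \<Rightarrow> real \<Rightarrow> real"
  defines "R \<equiv> 10 * real DIM('a) + 1"
  assumes \<beta>: "0 < \<beta>" "\<beta> \<le> real DIM('a)" and f: "orthogonal_transformation f"
    and \<theta>: "0 < \<theta>" "\<theta> * 2 powr \<beta> \<le> omega \<beta>" and \<delta>: "0 < \<delta>" "4 * \<delta> * 10 powr \<beta> \<le> \<theta>"
    and small: "\<theta> * R powr \<beta> + \<delta> < omega \<beta> * (1 / 2) powr \<beta>" and A: "0 \<le> A"
    and weak: "\<And>b s. (b, s) \<in> subcubes f Q0 \<Longrightarrow>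
        hcontent \<beta> {x \<in> cube f b s. \<bar>u x - c b s\<bar> > A} \<le> ennreal (\<delta> * s powr \<beta>)"
    and bs: "(b, s) \<in> subcubes f Q0"
  shows "hcontent \<beta> {x \<in> cube f b s. \<bar>u x - c b s\<bar> > A + 2 * A * real n}
      \<le> ennreal (omega \<beta> * (real DIM('a) + 1) powr \<beta> * (1 / 2) ^ n * s powr \<beta>)"
  using bs
proof (induction n arbitrary: b s)
  case 0
  have "hcontent \<beta> {x \<in> cube f b s. \<bar>u x - c b s\<bar> > A + 2 * A * real 0} \<le> hcontent \<beta> (cube f b s)"
    by (intro hcontent_mono) auto
  also have "\<dots> \<le> ennreal (omega \<beta> * ((real DIM('a) + 1) * s) powr \<beta>)"
    using 0 by (intro hcontent_cube_le f) (auto simp: subcubes_def)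
  finally show ?case using 0 by (simp add: powr_mult subcubes_def mult.assoc)
next
  case (Suc n)
  define K where "K = omega \<beta> * (real DIM('a) + 1) powr \<beta> * (1 / 2) ^ n"
  have K: "0 \<le> K" unfolding K_def using omega_pos[OF \<beta>(1)] by simp
  define V where "V b s t = {x \<in> cube f b s. \<bar>u x - c b s\<bar> > t}" for b s t
  have s: "0 < s" and Q: "cube f b s \<subseteq> Q0" using Suc.prems by (auto simp: subcubes_def)
  obtain J :: "'a set" and b' :: "'a \<Rightarrow> 'a" and L :: "'a \<Rightarrow> real" where J: "countable J"
    and cov: "V b s A \<subseteq> (\<Union>x\<in>J. cube f (b' x) (L x))"
    and L_sum: "(\<integral>\<^sup>+x. ennreal (L x powr \<beta>) \<partial>count_space J) \<le> ennreal (s powr \<beta> / 2)"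
    and L: "\<And>x. x \<in> J \<Longrightarrow> 0 < L x"
    and sub: "\<And>x. x \<in> J \<Longrightarrow> cube f (b' x) (L x) \<subseteq> cube f b s"
    and L_small: "\<And>x. x \<in> J \<Longrightarrow> hcontent \<beta> (V b s A \<inter> cube f (b' x) (L x)) \<le> ennreal (\<theta> * (R * L x) powr \<beta>)"
  proof (rule subcube_selection[OF \<beta>(1) f \<theta> \<delta> s, of "V b s A" b], goal_cases)
    case 1
    show ?case by (auto simp: V_def)
  next
    case 2
    show ?case unfolding V_def by (rule weak[OF Suc.prems])
  next
    case (3 J b' L)
    show ?case using 3(2-) unfolding R_def[symmetric] by (rule that)
  qed
  have sub': "(b' x, L x) \<in> subcubes f Q0" if "x \<in> J" for x
    using L[OF that] sub[OF that] Q by (auto simp: subcubes_def)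
  \<comment> \<open>Both exceptional sets have small content in the subcube, so some point lies in neither.\<close>
  have near: "\<bar>c (b' x) (L x) - c b s\<bar> \<le> 2 * A" if x: "x \<in> J" for x
  proof (rule ccontr)
    assume far: "\<not> ?thesis"
    have "cube f (b' x) (L x) \<subseteq> (V b s A \<inter> cube f (b' x) (L x)) \<union> V (b' x) (L x) A"
    proof
      fix z assume "z \<in> cube f (b' x) (L x)"
      moreover have "\<bar>u z - c b s\<bar> > A \<or> \<bar>u z - c (b' x) (L x)\<bar> > A" using far by linarith
      ultimately show "z \<in> (V b s A \<inter> cube f (b' x) (L x)) \<union> V (b' x) (L x) A"
        using sub[OF x] by (auto simp: V_def)
    qed
    then have "hcontent \<beta> (cube f (b' x) (L x))
        \<le> hcontent \<beta> (V b s A \<inter> cube f (b' x) (L x)) + hcontent \<beta> (V (b' x) (L x) A)"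
      by (rule order_trans[OF hcontent_mono hcontent_Un_le])
    also have "\<dots> \<le> ennreal (\<theta> * (R * L x) powr \<beta>) + ennreal (\<delta> * L x powr \<beta>)"
      by (intro add_mono L_small[OF x]) (unfold V_def, rule weak[OF sub'[OF x]])
    also have "(R * L x) powr \<beta> = R powr \<beta> * L x powr \<beta>"
      by (rule powr_mult)
    also have "ennreal (\<theta> * (R powr \<beta> * L x powr \<beta>)) + ennreal (\<delta> * L x powr \<beta>) = ennreal ((\<theta> * R powr \<beta> + \<delta>) * L x powr \<beta>)"
      using \<theta> \<delta> by (simp add: ennreal_plus[symmetric] distrib_right mult.assoc del: ennreal_plus)
    also have "\<dots> < ennreal (omega \<beta> * (1 / 2) powr \<beta> * L x powr \<beta>)"
      using small L[OF x] omega_pos[OF \<beta>(1)] by (intro ennreal_lessI mult_strict_right_mono) auto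
    also have "omega \<beta> * (1 / 2) powr \<beta> * L x powr \<beta> = omega \<beta> * (L x / 2) powr \<beta>"
      using powr_mult[of "1/2" "L x" \<beta>] L[OF x] by simp
    also have "ennreal \<dots> \<le> hcontent \<beta> (cube f (b' x) (L x))"
      by (intro hcontent_cube_ge \<beta> f L x)
    finally show False by simp
  qed
  \<comment> \<open>The level exceeds \<open>A\<close>, so each point lies in some selected subcube;
    passing to its constant costs at most \<open>2 * A\<close>, exactly one step of the
    level.\<close>
  have "V b s (A + 2 * A * real (Suc n)) \<subseteq> (\<Union>x\<in>J. V (b' x) (L x) (A + 2 * A * real n))"
  proof
    fix z assume z: "z \<in> V b s (A + 2 * A * real (Suc n))"
    then have gt: "A + 2 * A * real n + 2 * A < \<bar>u z - c b s\<bar>" by (simp add: V_def algebra_simps)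
    have "0 \<le> 2 * A * real n + 2 * A" using A by simp
    then have "z \<in> V b s A" using z gt by (simp add: V_def)
    then obtain x where x: "x \<in> J" "z \<in> cube f (b' x) (L x)" using cov by blast
    then have "z \<in> V (b' x) (L x) (A + 2 * A * real n)"
      using near[OF x(1)] gt by (simp add: V_def)
    then show "z \<in> (\<Union>x\<in>J. V (b' x) (L x) (A + 2 * A * real n))" using x by blast
  qed
  then have "hcontent \<beta> (V b s (A + 2 * A * real (Suc n)))
      \<le> (\<integral>\<^sup>+x. hcontent \<beta> (V (b' x) (L x) (A + 2 * A * real n)) \<partial>count_space J)"
    using hcontent_UN_le[OF J] by (rule order_trans[OF hcontent_mono])
  \<comment> \<open>The induction hypothesis bounds each subcube's share; \<open>L_sum\<close> then
    supplies the further factor 1/2.\<close>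
  also have "\<dots> \<le> (\<integral>\<^sup>+x. ennreal K * ennreal (L x powr \<beta>) \<partial>count_space J)"
    using Suc.IH[OF sub'] K by (intro nn_integral_mono) (simp add: V_def K_def ennreal_mult'[symmetric])
  also have "\<dots> = ennreal K * (\<integral>\<^sup>+x. ennreal (L x powr \<beta>) \<partial>count_space J)"
    by (rule nn_integral_cmult) simp
  also have "\<dots> \<le> ennreal K * ennreal (s powr \<beta> / 2)"
    using L_sum by (rule mult_left_mono) simp
  also have "\<dots> = ennreal (K * (s powr \<beta> / 2))" using K by (simp add: ennreal_mult'[symmetric])
  finally show ?case by (simp add: V_def K_def mult.assoc mult.left_commute)
qed

section \<open>From the BMO norm to exponential decay\<close>

theorem theorem1p3:
  fixes \<beta> :: real and f :: "'a::euclidean_space \<Rightarrow> 'a" and a0 :: 'a and l0 :: real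
  assumes "0 < \<beta>" and "\<beta> \<le> real DIM('a)"
    and "orthogonal_transformation f" and "0 < l0"
  shows "\<exists>c C. 0 < c \<and> 0 < C \<and>
     (\<forall>u \<in> BMO \<beta> f (cube f a0 l0). \<forall>(b, s) \<in> subcubes f (cube f a0 l0).
        \<exists>cQ :: real. \<forall>t > 0.
          hcontent \<beta> {x \<in> cube f b s. \<bar>u x - cQ\<bar> > t}
            \<le> ennreal (C * s powr \<beta> *
                 exp (- c * t / enn2real (bmo_norm \<beta> f (cube f a0 l0) u))))"
proof -
  note f = assms(3)
  define Q0 where "Q0 = cube f a0 l0"
  define R where "R = 10 * real DIM('a) + 1"
  \<comment> \<open>\<open>\<theta> * R powr \<beta>\<close> is half of the lower bound for the
    content of a unit cube; \<delta> is smaller than \<theta>, which keeps the sum in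
    \<open>small\<close> strictly below that bound.\<close>
  define \<theta> where "\<theta> = omega \<beta> * (1 / 2) powr \<beta> / (2 * R powr \<beta>)"
  define \<delta> where "\<delta> = \<theta> / (4 * 10 powr \<beta>)"
  define K where "K = omega \<beta> * (real DIM('a) + 1) powr \<beta>"
  \<comment> \<open>The bound halves whenever the level rises by \<open>2 * A\<close>, where
    \<open>A = 2 * N / \<delta>\<close> and \<open>N\<close> is the norm, so the rate is
    \<open>ln 2 / (2 * A) = c0 / N\<close>.\<close>
  define c0 where "c0 = ln 2 * \<delta> / 4"
  have om: "0 < omega \<beta>" using assms(1) by (rule omega_pos)
  have R1: "1 \<le> R powr \<beta>" using assms(1) by (intro ge_one_powr_ge_zero) (auto simp: R_def)
  have ten: "1 \<le> (10::real) powr \<beta>" using assms(1) by (intro ge_one_powr_ge_zero) auto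
  have half: "(1 / 2) powr \<beta> * 2 powr \<beta> = (1::real)" by (simp add: powr_mult[symmetric])
  have R0: "0 < R" by (simp add: R_def add_nonneg_pos)
  have \<theta>: "0 < \<theta>" using om R0 by (simp add: \<theta>_def)
  have "\<theta> * 2 powr \<beta> = omega \<beta> * ((1 / 2) powr \<beta> * 2 powr \<beta>) / (2 * R powr \<beta>)"
    by (simp add: \<theta>_def)
  also have "\<dots> \<le> omega \<beta>" unfolding half using om R0 R1 mult_left_mono[of 1 "2 * R powr \<beta>" "omega \<beta>"] by (simp add: divide_le_eq)
  finally have \<theta>_le: "\<theta> * 2 powr \<beta> \<le> omega \<beta>" .
  have \<delta>: "0 < \<delta>" using \<theta> by (simp add: \<delta>_def)
  have \<delta>_le: "4 * \<delta> * 10 powr \<beta> \<le> \<theta>" by (simp add: \<delta>_def)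
  have "\<delta> < \<theta> * 1" using \<theta> ten by (simp add: \<delta>_def field_simps)
  also have "\<dots> \<le> \<theta> * R powr \<beta>" using \<theta> R1 by (intro mult_left_mono) auto
  finally have "\<theta> * R powr \<beta> + \<delta> < 2 * (\<theta> * R powr \<beta>)" by simp
  also have "\<dots> = omega \<beta> * (1 / 2) powr \<beta>" using R0 by (simp add: \<theta>_def)
  finally have small: "\<theta> * R powr \<beta> + \<delta> < omega \<beta> * (1 / 2) powr \<beta>" .
  have K: "0 < K" using om by (simp add: K_def)
  have "\<exists>cQ. \<forall>t>0. hcontent \<beta> {x \<in> cube f b s. \<bar>u x - cQ\<bar> > t}
      \<le> ennreal (4 * K * s powr \<beta> * exp (- c0 * t / enn2real (bmo_norm \<beta> f Q0 u)))"
    if u: "u \<in> BMO \<beta> f Q0" and bs: "(b, s) \<in> subcubes f Q0" for u b s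
  proof -
    define N where "N = enn2real (bmo_norm \<beta> f Q0 u)"
    have N_eq: "bmo_norm \<beta> f Q0 u = ennreal N" using u by (simp add: BMO_def N_def less_top)
    have s: "0 < s" using bs by (simp add: subcubes_def)
    consider "N = 0" | "0 < N" unfolding N_def using enn2real_nonneg less_eq_real_def by metis
    then show ?thesis
    proof cases
      case 1 \<comment> \<open>Division by zero makes the exponential 1.\<close>
      have "hcontent \<beta> {x \<in> cube f b s. \<bar>u x - 0\<bar> > t} \<le> ennreal (4 * K * s powr \<beta> * exp (- c0 * t / N))" for t
      proof -
        have "hcontent \<beta> {x \<in> cube f b s. \<bar>u x - 0\<bar> > t} \<le> hcontent \<beta> (cube f b s)"
          by (intro hcontent_mono) auto
        also have "\<dots> \<le> ennreal (K * s powr \<beta>)"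
          using hcontent_cube_le[OF f s] s by (simp add: K_def powr_mult mult.assoc)
        also have "\<dots> \<le> ennreal (4 * K * s powr \<beta> * exp (- c0 * t / N))"
          using K 1 by (intro ennreal_leI) simp
        finally show ?thesis .
      qed
      then show ?thesis unfolding N_def by blast
    next
      case 2
      \<comment> \<open>The infimum over constants need not be attained, so a constant with
        oscillation below \<open>2 * N\<close> is taken, which exists as \<open>N\<close> is
        positive. Chebyshev at level \<open>A\<close> then gives content at most
        \<open>2 * N / A * s powr \<beta> = \<delta> * s powr \<beta>\<close>.\<close>
      define A where "A = 2 * N / \<delta>"
      have A: "0 < A" using 2 \<delta> by (simp add: A_def)
      have "\<exists>c. hcontent \<beta> {x \<in> cube f b s. \<bar>u x - c\<bar> > A} \<le> ennreal (\<delta> * s powr \<beta>)"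
        if bs: "(b, s) \<in> subcubes f Q0" for b s
      proof -
        have s: "0 < s" using bs by (simp add: subcubes_def)
        have "(INF c \<in> UNIV. ennreal (s powr (-\<beta>)) * choquet \<beta> (cube f b s) (\<lambda>x. \<bar>u x - c\<bar>)) \<le> ennreal N"
          using SUP_upper[OF bs, of "\<lambda>(b, s). INF c \<in> UNIV. ennreal (s powr (-\<beta>)) * choquet \<beta> (cube f b s) (\<lambda>x. \<bar>u x - c\<bar>)"]
          by (simp add: N_eq[symmetric] bmo_norm_def)
        also have "\<dots> < ennreal (2 * N)" using 2 by (simp add: ennreal_less_iff)
        finally obtain c where c: "ennreal (s powr (-\<beta>)) * choquet \<beta> (cube f b s) (\<lambda>x. \<bar>u x - c\<bar>) < ennreal (2 * N)"
          unfolding INF_less_iff by blast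
        let ?h = "hcontent \<beta> {x \<in> cube f b s. \<bar>u x - c\<bar> > A}"
        have "ennreal (s powr (-\<beta>) * A) * ?h = ennreal (s powr (-\<beta>)) * (ennreal A * ?h)"
          using A by (simp add: ennreal_mult' mult.assoc)
        also have "\<dots> \<le> ennreal (s powr (-\<beta>)) * choquet \<beta> (cube f b s) (\<lambda>x. \<bar>u x - c\<bar>)"
          by (intro mult_left_mono choquet_Chebyshev A) simp
        also have "\<dots> \<le> ennreal (2 * N)" using c by simp
        also have "\<dots> = ennreal (s powr (-\<beta>) * A) * ennreal (\<delta> * s powr \<beta>)"
          using A \<delta> s by (simp add: ennreal_mult'[symmetric] powr_minus A_def field_simps)
        finally have "?h \<le> ennreal (\<delta> * s powr \<beta>)"
          using A s by (simp add: ennreal_mult_le_mult_iff)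
        then show ?thesis ..
      qed
      then obtain c where c: "\<And>b s. (b, s) \<in> subcubes f Q0 \<Longrightarrow>
          hcontent \<beta> {x \<in> cube f b s. \<bar>u x - c b s\<bar> > A} \<le> ennreal (\<delta> * s powr \<beta>)"
        by metis
      have "hcontent \<beta> {x \<in> cube f b s. \<bar>u x - c b s\<bar> > t} \<le> ennreal (4 * K * s powr \<beta> * exp (- c0 * t / N))"
        if t: "0 < t" for t
      proof -
        define m where "m = t / (2 * A)"
        \<comment> \<open>For \<open>t \<ge> A\<close> this is the largest number of steps with
          \<open>A + 2 * A * n \<le> t\<close>; for \<open>t < A\<close> it is 0 and the whole cube
          is used. In both cases \<open>m \<le> n + 2\<close>, and these two halvings account for
          the 4 in the constant \<open>4 * K\<close>.\<close>
        define n where "n = nat \<lfloor>m - 1 / 2\<rfloor>"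
        have m: "0 < m" using t A by (simp add: m_def)
        have n_bound: "m \<le> real n + 2" unfolding n_def by linarith
        have "hcontent \<beta> {x \<in> cube f b s. \<bar>u x - c b s\<bar> > t} \<le> ennreal (K * (1 / 2) ^ n * s powr \<beta>)"
        proof (cases "m < 1 / 2")
          case True
          then have "n = 0" by (simp add: n_def)
          have "hcontent \<beta> {x \<in> cube f b s. \<bar>u x - c b s\<bar> > t} \<le> hcontent \<beta> (cube f b s)"
            by (intro hcontent_mono) auto
          also have "\<dots> \<le> ennreal (K * (1 / 2) ^ n * s powr \<beta>)"
            using hcontent_cube_le[OF f s] s by (simp add: K_def powr_mult mult.assoc \<open>n = 0\<close>)
          finally show ?thesis .
        next
          case False
          then have "real n \<le> m - 1 / 2" by (simp add: n_def)
          then have "2 * A * real n \<le> 2 * A * (m - 1 / 2)" using A by (intro mult_left_mono) auto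
          also have "\<dots> = t - A" using A by (simp add: m_def field_simps)
          finally have "hcontent \<beta> {x \<in> cube f b s. \<bar>u x - c b s\<bar> > t}
              \<le> hcontent \<beta> {x \<in> cube f b s. \<bar>u x - c b s\<bar> > A + 2 * A * real n}"
            by (intro hcontent_mono) auto
          also have "\<dots> \<le> ennreal (K * (1 / 2) ^ n * s powr \<beta>)"
            unfolding K_def
            by (rule content_decay[OF assms(1,2) f \<theta> \<theta>_le \<delta> \<delta>_le small[unfolded R_def] less_imp_le[OF A] c bs])
          finally show ?thesis .
        qed
        also have "\<dots> \<le> ennreal (4 * K * s powr \<beta> * exp (- c0 * t / N))"
        proof (rule ennreal_leI)
          have "(1 / 2 :: real) ^ n = 4 * 2 powr (- (real n + 2))"
            by (simp add: powr_diff powr_minus powr_realpow power_one_over inverse_eq_divide)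
          also have "\<dots> \<le> 4 * 2 powr (- m)" using n_bound by simp
          also have "(2::real) powr (- m) = exp (- c0 * t / N)"
            using 2 \<delta> by (simp add: powr_def m_def A_def c0_def field_simps)
          finally show "K * (1 / 2) ^ n * s powr \<beta> \<le> 4 * K * s powr \<beta> * exp (- c0 * t / N)"
            using K mult_left_mono[of "(1/2)^n" "4 * exp (- c0 * t / N)" "K * s powr \<beta>"]
            by (simp add: mult.assoc mult.left_commute mult.commute)
        qed
        finally show ?thesis .
      qed
      then show ?thesis unfolding N_def by blast
    qed
  qed
  moreover have "0 < c0" using \<delta> by (simp add: c0_def)
  ultimately show ?thesis using K unfolding Q0_def by (intro exI[of _ c0] exI[of _ "4 * K"]) auto
qed

end
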